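(* Let $E(p_1,p_2)$ be a smooth function that is symmetric and convex (concave upward) on $M=\{(p_1,p_2):p_1+p_2=1,\ p_1,p_2\ge0\}$. For any weight function $\theta$ on $K_2$, the global Ricci curvature bound $\kappa_{\min}=\inf_{p}\kappa(p)$ (infimum over the interior of $M$) satisfies $$\kappa_{\min}\le 8\,\frac{E(1,0)-E(\frac12,\frac12)}{\left(\int_0^1\frac{1}{\sqrt{\theta(x,1-x)}}dx\right)^2},$$ with equality if and only if there is a constant $C$ such that $\theta(p_1,p_2)=2C\frac{E(p_1,p_2)-E(\frac12,\frac12)}{\left(\frac{\partial E}{\partial p_1}-\frac{\partial E}{\partial p_2}\right)^2}$ on $M$.
   Context: A weight function is $\theta:[0,\infty)^2\to[0,\infty)$, continuous, $C^\infty$ on $(0,\infty)^2$, symmetric and positive on $(0,\infty)^2$; on $K_2$, $\theta_{12}=\theta(p_1,p_2)$. The local Ricci curvature bound on $K_2$ at a point $p=(p_1,p_2)$ of the interior of $M$ is $$\kappa(p)=\frac12\left(\frac{\partial\theta_{12}}{\partial p_1}-\frac{\partial\theta_{12}}{\partial p_2}\right)\left(\frac{\partial E}{\partial p_1}-\frac{\partial E}{\partial p_2}\right)+\theta_{12}\left(\frac{\partial^2E}{\partial p_1^2}-2\frac{\partial^2E}{\partial p_1\partial p_2}+\frac{\partial^2E}{\partial p_2^2}\right).$$ *)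

theory Defs
  imports "HOL-Analysis.Analysis"
begin

definition pd1 :: "(real \<times> real \<Rightarrow> real) \<Rightarrow> real \<times> real \<Rightarrow> real" where
  "pd1 f p = deriv (\<lambda>x. f (x, snd p)) (fst p)"

definition pd2 :: "(real \<times> real \<Rightarrow> real) \<Rightarrow> real \<times> real \<Rightarrow> real" where
  "pd2 f p = deriv (\<lambda>y. f (fst p, y)) (snd p)"

text \<open>Both notions below are meant for open \<open>U\<close>, on which the values of the (total) partial
  derivatives depend only on \<open>f\<close> restricted to \<open>U\<close>.\<close>

primrec Ck_on :: "nat \<Rightarrow> (real \<times> real) set \<Rightarrow> (real \<times> real \<Rightarrow> real) \<Rightarrow> bool" where
  "Ck_on 0 U f \<longleftrightarrow> continuous_on U f"
| "Ck_on (Suc k) U f \<longleftrightarrow>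
     (\<forall>p\<in>U. f differentiable (at p)) \<and> Ck_on k U (pd1 f) \<and> Ck_on k U (pd2 f)"

definition Cinf_on :: "(real \<times> real) set \<Rightarrow> (real \<times> real \<Rightarrow> real) \<Rightarrow> bool" where
  "Cinf_on U f \<longleftrightarrow> (\<forall>k. Ck_on k U f)"

definition simplex_K2 :: "(real \<times> real) set" where
  "simplex_K2 = {(p1, p2). p1 + p2 = 1 \<and> 0 \<le> p1 \<and> 0 \<le> p2}"

definition interior_K2 :: "(real \<times> real) set" where
  "interior_K2 = {(p1, p2). p1 + p2 = 1 \<and> 0 < p1 \<and> 0 < p2}"

lemma simplex_K2_segment: "simplex_K2 = closed_segment (0, 1) (1, 0)"
  by (auto simp: simplex_K2_def closed_segment_def)

lemma interior_K2_rel_interior: "interior_K2 = rel_interior simplex_K2"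
  unfolding simplex_K2_segment rel_interior_closed_segment
  by (auto simp: interior_K2_def open_segment_image_interval)

definition weight_function :: "(real \<times> real \<Rightarrow> real) \<Rightarrow> bool" where
  "weight_function \<theta> \<longleftrightarrow>
     (\<forall>p \<in> {0..} \<times> {0..}. 0 \<le> \<theta> p) \<and>
     continuous_on ({0..} \<times> {0..}) \<theta> \<and>
     Cinf_on ({0<..} \<times> {0<..}) \<theta> \<and>
     (\<forall>x>0. \<forall>y>0. \<theta> (x, y) = \<theta> (y, x)) \<and>
     (\<forall>x>0. \<forall>y>0. 0 < \<theta> (x, y))"

definition ricci_K2 :: "(real \<times> real \<Rightarrow> real) \<Rightarrow> (real \<times> real \<Rightarrow> real) \<Rightarrow> real \<times> real \<Rightarrow> real" where
  "ricci_K2 \<theta> E p =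
     1 / 2 * (pd1 \<theta> p - pd2 \<theta> p) * (pd1 E p - pd2 E p)
     + \<theta> p * (pd1 (pd1 E) p - 2 * pd1 (pd2 E) p + pd2 (pd2 E) p)"

text \<open>The local bound may be unbounded below near the end points of the simplex, so its infimum
  is an extended real.\<close>

definition ricci_min_K2 :: "(real \<times> real \<Rightarrow> real) \<Rightarrow> (real \<times> real \<Rightarrow> real) \<Rightarrow> ereal" where
  "ricci_min_K2 \<theta> E = (INF p\<in>interior_K2. ereal (ricci_K2 \<theta> E p))"

text \<open>The integral may be infinite, as \<open>\<theta>\<close> may vanish at the end points; a bound with
  \<open>\<infinity>\<close> in the denominator is then \<open>0\<close>.\<close>

definition length_K2 :: "(real \<times> real \<Rightarrow> real) \<Rightarrow> ereal" where
  "length_K2 \<theta> = enn2ereal (\<integral>\<^sup>+x\<in>{0..1}. ennreal (1 / sqrt (\<theta> (x, 1 - x))) \<partial>lborel)"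

end

theory Submission
  imports Defs
begin

text \<open>
  Parametrise the simplex by \<open>x \<mapsto> (x, 1 - x)\<close> and let \<open>s\<close> be arc length
  measured from the midpoint, so that \<open>ds/dx = 1 / sqrt (\<theta> (x, 1 - x))\<close>. In this parameter the
  curvature \<open>\<kappa>\<close> is exactly the second derivative of \<open>E\<close>, and \<open>dE/ds\<close> vanishes at the midpoint.
  Hence \<open>K \<le> \<kappa>\<close> gives \<open>E - E (1/2, 1/2) \<ge> K s\<^sup>2 / 2\<close>, and letting \<open>s\<close> tend to half the total
  length yields the bound. Equality forces \<open>E - E (1/2, 1/2) = K s\<^sup>2 / 2\<close> throughout, which says
  \<open>(dE/ds)\<^sup>2 = 2 K (E - E (1/2, 1/2))\<close>. Conversely, differentiating this relation shows
  \<open>\<kappa> = C\<close> wherever \<open>dE/ds \<noteq> 0\<close>, and continuity of \<open>\<kappa>\<close> propagates this to the whole interval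
  unless \<open>E\<close> is constant.
\<close>

section \<open>Partial derivatives in the plane\<close>

lemma has_derivative_imp_pd:
  assumes "(f has_derivative f') (at (x, y))"
  shows "((\<lambda>u. f (u, y)) has_real_derivative f' (1, 0)) (at x)"
    and "((\<lambda>u. f (x, u)) has_real_derivative f' (0, 1)) (at y)"
    and "y = a - x \<Longrightarrow> ((\<lambda>u. f (u, a - u)) has_real_derivative f' (1, -1)) (at x)"
proof -
  have lin: "linear f'"
    using assms has_derivative_linear by blast
  have "((\<lambda>u. f (u, y)) has_derivative (\<lambda>h. f' (h, 0))) (at x)"
    using has_derivative_compose[OF has_derivative_Pair[OF has_derivative_ident has_derivative_const] assms] .
  moreover have "(\<lambda>h. f' (h, 0)) = (*) (f' (1, 0))"
  proof
    show "f' (h, 0) = f' (1, 0) * h" for h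
      using linear_cmul[OF lin, of h "(1, 0)"] by simp
  qed
  ultimately show "((\<lambda>u. f (u, y)) has_real_derivative f' (1, 0)) (at x)"
    by (simp only: has_field_derivative_def)
  have "((\<lambda>u. f (x, u)) has_derivative (\<lambda>h. f' (0, h))) (at y)"
    using has_derivative_compose[OF has_derivative_Pair[OF has_derivative_const has_derivative_ident] assms] .
  moreover have "(\<lambda>h. f' (0, h)) = (*) (f' (0, 1))"
  proof
    show "f' (0, h) = f' (0, 1) * h" for h
      using linear_cmul[OF lin, of h "(0, 1)"] by simp
  qed
  ultimately show "((\<lambda>u. f (x, u)) has_real_derivative f' (0, 1)) (at y)"
    by (simp only: has_field_derivative_def)
  assume y: "y = a - x"
  have "((\<lambda>u. f (u, a - u)) has_derivative (\<lambda>h. f' (h, -h))) (at x)"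
    using has_derivative_compose[OF has_derivative_Pair[OF has_derivative_ident
          has_derivative_diff[OF has_derivative_const has_derivative_ident]] assms[unfolded y]]
    by simp
  moreover have "(\<lambda>h. f' (h, -h)) = (*) (f' (1, -1))"
  proof
    show "f' (h, -h) = f' (1, -1) * h" for h
      using linear_cmul[OF lin, of h "(1, -1)"] by simp
  qed
  ultimately show "((\<lambda>u. f (u, a - u)) has_real_derivative f' (1, -1)) (at x)"
    by (simp only: has_field_derivative_def)
qed

lemma differentiable_imp_pd1:
  assumes "f differentiable (at (x, y))"
  shows "((\<lambda>u. f (u, y)) has_real_derivative pd1 f (x, y)) (at x)"
  using assms has_derivative_imp_pd(1) DERIV_imp_deriv
  unfolding differentiable_def pd1_def by fastforce

lemma differentiable_imp_pd2:
  assumes "f differentiable (at (x, y))"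
  shows "((\<lambda>u. f (x, u)) has_real_derivative pd2 f (x, y)) (at y)"
  using assms has_derivative_imp_pd(2) DERIV_imp_deriv
  unfolding differentiable_def pd2_def by fastforce

text \<open>Chain rule in the direction \<open>(1, -1)\<close>: along the simplex
  \<open>pd1 - pd2\<close> becomes an ordinary derivative, which reduces the theorem to functions of
  one variable.\<close>

lemma differentiable_imp_antidiagonal_derivative:
  assumes "f differentiable (at (x, a - x))"
  shows "((\<lambda>u. f (u, a - u)) has_real_derivative pd1 f (x, a - x) - pd2 f (x, a - x)) (at x)"
proof -
  obtain f' where f': "(f has_derivative f') (at (x, a - x))"
    using assms unfolding differentiable_def by blast
  have "pd1 f (x, a - x) = f' (1, 0)" "pd2 f (x, a - x) = f' (0, 1)"
    using has_derivative_imp_pd(1,2)[OF f'] DERIV_imp_deriv unfolding pd1_def pd2_def by fastforce+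
  moreover have "f' (1, -1) = f' (1, 0) - f' (0, 1)"
    using linear_diff[OF has_derivative_linear[OF f'], of "(1, 0)" "(0, 1)"] by simp
  ultimately show ?thesis
    using has_derivative_imp_pd(3)[OF f', of a] by simp
qed

text \<open>The mean value theorem applied twice, first to \<open>f u (b+h) - f u b\<close> as a
  function of \<open>u\<close>, then to \<open>g x\<close>.\<close>

lemma mixed_difference_mean_value:
  fixes f g k :: "real \<Rightarrow> real \<Rightarrow> real"
  assumes "0 < h"
    and f: "\<And>x y. x \<in> {a..a+h} \<Longrightarrow> y \<in> {b..b+h} \<Longrightarrow> ((\<lambda>u. f u y) has_real_derivative g x y) (at x)"
    and g: "\<And>x y. x \<in> {a..a+h} \<Longrightarrow> y \<in> {b..b+h} \<Longrightarrow> (g x has_real_derivative k x y) (at y)"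
  obtains x y where "x \<in> {a..a+h}" "y \<in> {b..b+h}"
    "f (a+h) (b+h) - f a (b+h) - f (a+h) b + f a b = h * h * k x y"
proof -
  have "\<exists>x. a < x \<and> x < a+h \<and> (f (a+h) (b+h) - f (a+h) b) - (f a (b+h) - f a b)
           = (a+h-a) * (g x (b+h) - g x b)"
    using assms(1) by (intro MVT2 DERIV_diff f) auto
  then obtain x where x: "a < x" "x < a+h"
    "(f (a+h) (b+h) - f (a+h) b) - (f a (b+h) - f a b) = h * (g x (b+h) - g x b)"
    by auto
  have "\<exists>y. b < y \<and> y < b+h \<and> g x (b+h) - g x b = (b+h-b) * k x y"
    using assms(1) x by (intro MVT2 g) auto
  then obtain y where y: "b < y" "y < b+h" "g x (b+h) - g x b = h * k x y"
    by auto
  show thesis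
  proof (rule that)
    have "f (a+h) (b+h) - f a (b+h) - f (a+h) b + f a b = h * (g x (b+h) - g x b)"
      using x(3) by linarith
    thus "f (a+h) (b+h) - f a (b+h) - f (a+h) b + f a b = h * h * k x y"
      by (simp only: y(3) mult.assoc)
  qed (use x y in auto)
qed

text \<open>Schwarz's theorem: the second difference over a small square is \<open>h * h\<close>
  times either mixed partial at some point of the square, and both are continuous. Differentiating
  \<open>pd1 E - pd2 E\<close> along the simplex produces both orders, while \<open>ricci_K2\<close>
  contains only one.\<close>

lemma mixed_partials_commute:
  assumes U: "open U" "p \<in> U" and f: "Ck_on 2 U f"
  shows "pd2 (pd1 f) p = pd1 (pd2 f) p"
proof (rule ccontr)
  assume neq: "\<not> ?thesis"
  have diff: "f differentiable (at q)" "pd1 f differentiable (at q)" "pd2 f differentiable (at q)"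
    if "q \<in> U" for q
    using f that by (auto simp: numeral_2_eq_2)
  have cont: "continuous_on U (pd2 (pd1 f))" "continuous_on U (pd1 (pd2 f))"
    using f by (auto simp: numeral_2_eq_2)
  \<comment> \<open>Half the gap: numbers at distance less than \<open>\<epsilon>\<close> from the
    two values at \<open>p\<close> cannot coincide.\<close>
  define \<epsilon> where "\<epsilon> = dist (pd2 (pd1 f) p) (pd1 (pd2 f) p) / 2"
  have \<epsilon>: "\<epsilon> > 0"
    using neq by (simp add: \<epsilon>_def)
  have ev: "\<forall>\<^sub>F q in nhds p. dist (k q) (k p) < \<epsilon>" if "continuous_on U k" for k :: "real \<times> real \<Rightarrow> real"
  proof -
    have "isCont k p"
      using that U continuous_on_eq_continuous_at by blast
    hence "(k \<longlongrightarrow> k p) (nhds p)"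
      by (simp add: isCont_def tendsto_at_iff_tendsto_nhds)
    thus ?thesis
      using \<epsilon> by (rule tendstoD)
  qed
  have "\<forall>\<^sub>F q in nhds p. q \<in> U \<and> dist (pd2 (pd1 f) q) (pd2 (pd1 f) p) < \<epsilon>
          \<and> dist (pd1 (pd2 f) q) (pd1 (pd2 f) p) < \<epsilon>"
    using ev[OF cont(1)] ev[OF cont(2)] U by (intro eventually_conj eventually_nhds_in_open) auto
  then obtain r where r: "r > 0" "\<And>q. dist q p < r \<Longrightarrow> q \<in> U \<and> dist (pd2 (pd1 f) q) (pd2 (pd1 f) p) < \<epsilon>
          \<and> dist (pd1 (pd2 f) q) (pd1 (pd2 f) p) < \<epsilon>"
    unfolding eventually_nhds_metric by blast
  obtain a b where p: "p = (a, b)"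
    by (cases p)
  \<comment> \<open>Each coordinate moves by at most \<open>r / 3\<close>, so the square stays in
    the ball of radius \<open>r\<close>.\<close>
  define h where "h = r / 3"
  have h: "h > 0"
    using r by (simp add: h_def)
  have near: "dist (x, y) p < r" if "x \<in> {a..a+h}" "y \<in> {b..b+h}" for x y
  proof -
    have "dist (x, y) p \<le> \<bar>x - a\<bar> + \<bar>y - b\<bar>"
      using sqrt_sum_squares_le_sum_abs[of "x - a" "y - b"] by (simp add: p dist_Pair_Pair dist_real_def)
    also have "\<dots> < r"
      using that r(1) by (auto simp: h_def)
    finally show ?thesis .
  qed
  let ?\<Delta> = "f (a+h, b+h) - f (a, b+h) - f (a+h, b) + f (a, b)"
  have sub: "(x, y) \<in> U" if "x \<in> {a..a+h}" "y \<in> {b..b+h}" for x y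
    using near[OF that] r(2) by blast
  obtain x y where xy: "x \<in> {a..a+h}" "y \<in> {b..b+h}" "?\<Delta> = h * h * pd2 (pd1 f) (x, y)"
    by (rule mixed_difference_mean_value[OF h, where f = "\<lambda>x y. f (x, y)"
          and g = "\<lambda>x y. pd1 f (x, y)" and k = "\<lambda>x y. pd2 (pd1 f) (x, y)"])
       (assumption | intro differentiable_imp_pd1 differentiable_imp_pd2 diff sub)+
  \<comment> \<open>Exchanging the coordinates evaluates the same second difference in the other
    order.\<close>
  obtain y' x' where xy': "x' \<in> {a..a+h}" "y' \<in> {b..b+h}" 
    "f (a+h, b+h) - f (a+h, b) - f (a, b+h) + f (a, b) = h * h * pd1 (pd2 f) (x', y')"
    by (rule mixed_difference_mean_value[OF h, where f = "\<lambda>y x. f (x, y)"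
          and g = "\<lambda>y x. pd2 f (x, y)" and k = "\<lambda>y x. pd1 (pd2 f) (x, y)"])
       (assumption | intro differentiable_imp_pd1 differentiable_imp_pd2 diff sub)+
  have "h * h * pd2 (pd1 f) (x, y) = h * h * pd1 (pd2 f) (x', y')"
    using xy(3) xy'(3) by linarith
  hence "pd2 (pd1 f) (x, y) = pd1 (pd2 f) (x', y')"
    using h by simp
  moreover have "dist (pd2 (pd1 f) (x, y)) (pd2 (pd1 f) p) < \<epsilon>"
    "dist (pd1 (pd2 f) (x', y')) (pd1 (pd2 f) p) < \<epsilon>"
    using r(2)[OF near[OF xy(1,2)]] r(2)[OF near[OF xy'(1,2)]] by simp_all
  ultimately show False
    using dist_triangle3[of "pd2 (pd1 f) p" "pd1 (pd2 f) p" "pd2 (pd1 f) (x, y)"]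
    by (simp add: \<epsilon>_def)
qed

section \<open>Energies on the unit interval parametrised by arc length\<close>

text \<open>\<open>e\<close>, \<open>d\<close>, \<open>c\<close> stand for \<open>E\<close> along the simplex and its first two derivatives, \<open>t\<close>, \<open>t'\<close> for
  \<open>\<theta>\<close> along the simplex and its derivative, and \<open>S\<close> for signed arc length from the midpoint.\<close>

locale arc_length_energy =
  fixes e d c t t' S :: "real \<Rightarrow> real"
  assumes e_deriv: "x \<in> {0..1} \<Longrightarrow> (e has_real_derivative d x) (at x)"
    and d_deriv: "x \<in> {0<..<1} \<Longrightarrow> (d has_real_derivative c x) (at x)"
    and t_deriv: "x \<in> {0<..<1} \<Longrightarrow> (t has_real_derivative t' x) (at x)"
    and S_deriv: "x \<in> {0<..<1} \<Longrightarrow> (S has_real_derivative 1 / sqrt (t x)) (at x)"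
    and S_mid: "S (1/2) = 0"
    and d_cont: "continuous_on {0..1} d"
    and t_cont: "continuous_on {0..1} t"
    and c_cont: "continuous_on {0<..<1} c"
    and t'_cont: "continuous_on {0<..<1} t'"
    and t_pos: "x \<in> {0<..<1} \<Longrightarrow> 0 < t x"
    and t_sym: "x \<in> {0<..<1} \<Longrightarrow> t (1 - x) = t x"
    and e_sym: "x \<in> {0..1} \<Longrightarrow> e (1 - x) = e x"
    and e_convex: "convex_on {0..1} e"
begin

definition \<kappa> :: "real \<Rightarrow> real" where
  "\<kappa> x = 1 / 2 * t' x * d x + t x * c x"

text \<open>The derivative of \<open>e\<close> with respect to arc length \<open>s\<close>, since
  \<open>ds/dx = 1 / sqrt (t x)\<close>.\<close>

definition v :: "real \<Rightarrow> real" where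
  "v x = d x * sqrt (t x)"

definition len :: ennreal where
  "len = (\<integral>\<^sup>+x\<in>{0..1}. ennreal (1 / sqrt (t x)) \<partial>lborel)"

lemma d_eq: "x \<in> {0<..<1} \<Longrightarrow> d x = v x * (1 / sqrt (t x))"
  using t_pos[of x] by (simp add: v_def)

lemma v_sq: "x \<in> {0<..<1} \<Longrightarrow> (v x)\<^sup>2 = t x * (d x)\<^sup>2"
  using t_pos[of x] by (simp add: v_def power_mult_distrib)

text \<open>The product rule for \<open>d * sqrt t\<close> gives
  \<open>(t * c + t' * d / 2) / sqrt t\<close>. Dividing by \<open>ds/dx\<close> identifies
  \<open>\<kappa>\<close> as the second derivative of the energy in arc length.\<close>

lemma v_deriv: "x \<in> {0<..<1} \<Longrightarrow> (v has_real_derivative \<kappa> x * (1 / sqrt (t x))) (at x)"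
  unfolding v_def[abs_def] \<kappa>_def using t_pos[of x]
  by (auto intro!: derivative_eq_intros d_deriv t_deriv simp: field_simps)

lemma \<kappa>_cont: "continuous_on {0<..<1} \<kappa>"
  unfolding \<kappa>_def[abs_def]
  by (intro continuous_intros c_cont t'_cont continuous_on_subset[OF d_cont]
      continuous_on_subset[OF t_cont]) auto

section \<open>Monotonicity, reflection symmetry and convexity\<close>

lemma S_deriv_pos:
  assumes "x \<in> {0<..<1}"
  obtains D where "(S has_real_derivative D) (at x)" "0 < D"
  using S_deriv[OF assms] t_pos[OF assms] by (meson real_sqrt_gt_zero zero_less_divide_1_iff)

lemma S_mono:
  assumes "0 < x" "x \<le> y" "y < 1"
  shows "S x \<le> S y"
proof (rule DERIV_nonneg_imp_nondecreasing[OF assms(2)])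
  fix z assume "x \<le> z" "z \<le> y"
  hence "z \<in> {0<..<1}"
    using assms by auto
  thus "\<exists>D. (S has_real_derivative D) (at z) \<and> 0 \<le> D"
    by (metis S_deriv_pos less_imp_le)
qed

lemma S_nonneg: "1/2 \<le> x \<Longrightarrow> x < 1 \<Longrightarrow> 0 \<le> S x"
  using S_mono[of "1/2" x] S_mid by simp

text \<open>Any point between the midpoint and 1 would serve; one positive value of \<open>S\<close>
  rules out total length zero.\<close>

lemma S_pos: "S (3/4) > 0"
proof -
  have "S (1/2) < S (3/4)"
  proof (rule DERIV_pos_imp_increasing[of "1/2" "3/4" S])
    fix z :: real assume "1/2 \<le> z" "z \<le> 3/4"
    hence "z \<in> {0<..<1}" by auto
    thus "\<exists>D. (S has_real_derivative D) (at z) \<and> 0 < D"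
      by (metis S_deriv_pos)
  qed simp
  thus ?thesis by (simp add: S_mid)
qed

lemma S_odd:
  assumes "x \<in> {0<..<1}"
  shows "S (1 - x) = - S x"
proof -
  have "S x + S (1 - x) = S (1/2) + S (1 - 1/2)"
  proof (rule DERIV_isconst3[of 0 1 _ _ "\<lambda>x. S x + S (1 - x)"])
    fix y :: real assume y: "y \<in> {0<..<1}"
    have "((\<lambda>y. S (1 - y)) has_real_derivative 1 / sqrt (t (1 - y)) * - 1) (at y)"
      by (rule DERIV_chain2[of S]) (use y in \<open>auto intro!: derivative_eq_intros S_deriv\<close>)
    from DERIV_add[OF S_deriv[OF y] this]
    show "((\<lambda>y. S y + S (1 - y)) has_real_derivative 0) (at y)"
      using t_sym[OF y] by simp
  qed (use assms in auto)
  thus ?thesis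
    by (simp add: S_mid)
qed

lemma d_odd:
  assumes "x \<in> {0<..<1}"
  shows "d (1 - x) = - d x"
proof -
  have "((\<lambda>y. e (1 - y)) has_real_derivative d (1 - x) * - 1) (at x)"
    by (rule DERIV_chain2[of e]) (use assms in \<open>auto intro!: derivative_eq_intros e_deriv\<close>)
  moreover have "((\<lambda>y. e (1 - y)) has_real_derivative d x) (at x)"
    by (rule has_field_derivative_transform_within_open[of e _ _ "{0<..<1}"])
       (use assms e_sym in \<open>auto intro: e_deriv\<close>)
  ultimately show ?thesis
    using DERIV_unique by fastforce
qed

lemma v_odd: "x \<in> {0<..<1} \<Longrightarrow> v (1 - x) = - v x"
  by (simp add: v_def d_odd t_sym)

lemma v_mid: "v (1/2) = 0"
  using v_odd[of "1/2"] by simp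

lemma e_above_tangent: "x \<in> {0<..<1} \<Longrightarrow> y \<in> {0..1} \<Longrightarrow> e x + d x * (y - x) \<le> e y"
  using convex_on_imp_above_tangent[OF e_convex, of x y "d x"]
    has_field_derivative_at_within[OF e_deriv[of x]] by simp

text \<open>Oddness forces \<open>d (1/2) = 0\<close>, so the tangent at the midpoint is
  horizontal.\<close>

lemma e_ge_mid: "x \<in> {0..1} \<Longrightarrow> e (1/2) \<le> e x"
  using e_above_tangent[of "1/2" x] d_odd[of "1/2"] by simp

lemma e_le_end:
  assumes "x \<in> {0..1}"
  shows "e x \<le> e 1"
proof -
  have "e ((1 - x) *\<^sub>R 0 + x *\<^sub>R 1) \<le> (1 - x) * e 0 + x * e 1"
    by (rule convex_onD[OF e_convex]) (use assms in auto)
  thus ?thesis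
    using e_sym[of 0] by (simp add: algebra_simps)
qed

text \<open>A critical point of a convex function is a global minimum. This handles the points where
  the quotient in the equality condition is undefined.\<close>

lemma critical_imp_min: "x \<in> {0<..<1} \<Longrightarrow> d x = 0 \<Longrightarrow> e x = e (1/2)"
  using e_above_tangent[of x "1/2"] e_ge_mid[of x] by simp

section \<open>Comparison with the parabola of constant curvature \<open>K\<close>\<close>

lemma v_minus_linear_deriv:
  "x \<in> {0<..<1} \<Longrightarrow>
    ((\<lambda>x. v x - K * S x) has_real_derivative (\<kappa> x - K) * (1 / sqrt (t x))) (at x)"
  by (auto intro!: derivative_eq_intros v_deriv S_deriv simp: algebra_simps diff_divide_distrib)

lemma e_minus_quadratic_deriv:
  assumes "x \<in> {0<..<1}"
  shows "((\<lambda>x. e x - K * (S x)\<^sup>2 / 2) has_real_derivative (v x - K * S x) * (1 / sqrt (t x))) (at x)"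
proof -
  have "((\<lambda>x. e x - K * (S x)\<^sup>2 / 2) has_real_derivative d x - K * S x * (1 / sqrt (t x))) (at x)"
    using assms by (auto intro!: derivative_eq_intros e_deriv S_deriv)
  thus ?thesis
    using d_eq[OF assms] by (simp add: algebra_simps diff_divide_distrib)
qed

lemma v_minus_linear_mono:
  assumes "\<And>x. x \<in> {0<..<1} \<Longrightarrow> K \<le> \<kappa> x" "1/2 \<le> x" "x \<le> y" "y < 1"
  shows "v x - K * S x \<le> v y - K * S y"
proof (rule DERIV_nonneg_imp_nondecreasing[OF assms(3)])
  fix z assume "x \<le> z" "z \<le> y"
  hence z: "z \<in> {0<..<1}"
    using assms by auto
  have "0 \<le> (\<kappa> z - K) * (1 / sqrt (t z))"
    using assms(1)[OF z] t_pos[OF z] by (intro mult_nonneg_nonneg) auto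
  with v_minus_linear_deriv[OF z, of K]
  show "\<exists>D. ((\<lambda>x. v x - K * S x) has_real_derivative D) (at z) \<and> 0 \<le> D"
    by blast
qed

text \<open>Both \<open>v\<close> and \<open>K * S\<close> vanish at the midpoint and
  \<open>v - K * S\<close> is nondecreasing to the right of it, so the derivative of
  \<open>e - K * S^2 / 2\<close> is nonnegative there.\<close>

lemma e_minus_quadratic_mono:
  assumes K: "\<And>x. x \<in> {0<..<1} \<Longrightarrow> K \<le> \<kappa> x" and "1/2 \<le> x" "x \<le> y" "y < 1"
  shows "e x - K * (S x)\<^sup>2 / 2 \<le> e y - K * (S y)\<^sup>2 / 2"
proof (rule DERIV_nonneg_imp_nondecreasing[OF assms(3)])
  fix z assume "x \<le> z" "z \<le> y"
  hence z: "z \<in> {0<..<1}" "1/2 \<le> z" "z < 1"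
    using assms by auto
  have "0 \<le> v z - K * S z"
    using v_minus_linear_mono[of K "1/2" z, OF K] z v_mid S_mid by simp
  hence "0 \<le> (v z - K * S z) * (1 / sqrt (t z))"
    using t_pos[OF z(1)] by (intro mult_nonneg_nonneg) auto
  with e_minus_quadratic_deriv[OF z(1), of K]
  show "\<exists>D. ((\<lambda>x. e x - K * (S x)\<^sup>2 / 2) has_real_derivative D) (at z) \<and> 0 \<le> D"
    by blast
qed

section \<open>Total length as the limit of \<open>2 * S x\<close>\<close>

lemma integrand_measurable:
  assumes "1/2 \<le> x" "x < 1"
  shows "(\<lambda>y. 1 / sqrt (t y) * indicator {1-x..x} y) \<in> borel_measurable borel"
proof -
  have "continuous_on {1-x..x} t"
    by (rule continuous_on_subset[OF t_cont]) (use assms in auto)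
  moreover have "sqrt (t y) \<noteq> 0" if "y \<in> {1-x..x}" for y
    using assms that t_pos[of y] by simp
  ultimately have "continuous_on {1-x..x} (\<lambda>y. 1 / sqrt (t y))"
    by (intro continuous_on_divide continuous_on_const continuous_on_real_sqrt) blast+
  from borel_measurable_continuous_on_indicator[OF _ this] show ?thesis
    by (simp add: mult.commute)
qed

lemma nn_integral_middle:
  assumes "1/2 \<le> x" "x < 1"
  shows "(\<integral>\<^sup>+y\<in>{1-x..x}. ennreal (1 / sqrt (t y)) \<partial>lborel) = ennreal (2 * S x)"
proof -
  let ?g = "\<lambda>y. 1 / sqrt (t y) * indicator {1-x..x} y"
  have pos: "0 < t y" "y \<in> {0<..<1}" if "y \<in> {1-x..x}" for y
    using assms that t_pos[of y] by auto
  have "((\<lambda>y. 1 / sqrt (t y)) has_integral (S x - S (1 - x))) {1-x..x}"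
  proof (rule fundamental_theorem_of_calculus)
    fix y assume "y \<in> {1-x..x}"
    from has_field_derivative_at_within[OF S_deriv[OF pos(2)[OF this]]]
    show "(S has_vector_derivative 1 / sqrt (t y)) (at y within {1-x..x})"
      by (simp add: has_real_derivative_iff_has_vector_derivative)
  qed (use assms in simp)
  moreover have "S x - S (1 - x) = 2 * S x"
    using assms S_odd[of x] by simp
  moreover have "?g = (\<lambda>y. if y \<in> {1-x..x} then 1 / sqrt (t y) else 0)"
    by (auto simp: indicator_def)
  ultimately have "(?g has_integral (2 * S x)) UNIV"
    using has_integral_restrict_UNIV[of "{1-x..x}" "\<lambda>y. 1 / sqrt (t y)" "2 * S x"] by simp
  moreover have "0 \<le> ?g y" for y
    using pos(1)[of y] by (auto simp: indicator_def less_imp_le)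
  ultimately have "(\<integral>\<^sup>+y. ennreal (?g y) \<partial>lborel) = ennreal (2 * S x)"
    by (intro nn_integral_has_integral_lborel integrand_measurable[OF assms])
  thus ?thesis
    by (simp add: nn_integral_set_ennreal)
qed

lemma S_le_len:
  assumes "1/2 \<le> x" "x < 1"
  shows "ennreal (2 * S x) \<le> len"
  unfolding nn_integral_middle[OF assms, symmetric] len_def
  using assms by (intro nn_integral_mono) (auto simp: indicator_def)

text \<open>Monotone convergence over compact intervals exhausting \<open>{0<..<1}\<close>; this
  also covers integrands that blow up at the end points.\<close>

lemma len_le:
  assumes B: "\<And>x. 1/2 \<le> x \<Longrightarrow> x < 1 \<Longrightarrow> 2 * S x \<le> B"
  shows "len \<le> ennreal B"
proof -
  \<comment> \<open>The summand 2 makes the sequence start at the midpoint; it increases to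
    1.\<close>
  define a :: "nat \<Rightarrow> real" where "a n = 1 - 1 / (real n + 2)" for n
  have a: "1/2 \<le> a n" "a n < 1" for n
    by (auto simp: a_def field_simps)
  let ?g = "\<lambda>y. ennreal (1 / sqrt (t y))"
  let ?f = "\<lambda>n y. ?g y * indicator {1 - a n..a n} y"
  have a_mono: "a m \<le> a n" if "m \<le> n" for m n
    using that by (auto simp: a_def field_simps)
  have inc: "incseq ?f"
  proof (intro incseq_SucI le_funI mult_left_mono)
    fix n y
    have "{1 - a n..a n} \<subseteq> {1 - a (Suc n)..a (Suc n)}"
      using a_mono[of n "Suc n"] by auto
    thus "indicator {1 - a n..a n} y \<le> (indicator {1 - a (Suc n)..a (Suc n)} y :: ennreal)"
      by (auto simp: indicator_def)
  qed simp
  have meas: "?f n \<in> borel_measurable lborel" for n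
  proof -
    have "?f n = (\<lambda>y. ennreal (1 / sqrt (t y) * indicator {1 - a n..a n} y))"
      by (auto simp: indicator_def)
    thus ?thesis
      using integrand_measurable[OF a] by simp
  qed
  have sup: "(SUP n. ?f n y) = ?g y * indicator {0<..<1} y" for y
  proof (cases "y \<in> {0<..<1}")
    case True
    define m where "m = min y (1 - y)"
    have "m > 0"
      using True by (auto simp: m_def)
    then obtain n where n: "1 / real (Suc n) < m"
      using nat_approx_posE by blast
    have "1 / (real n + 2) \<le> 1 / real (Suc n)"
      by (simp add: field_simps)
    hence "y \<in> {1 - a n..a n}"
      using n by (auto simp: a_def m_def)
    hence "?g y * indicator {0<..<1} y \<le> ?f n y"
      using True by simp
    moreover have "?f k y \<le> ?g y * indicator {0<..<1} y" for k
      using True by (simp add: indicator_def)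
    ultimately show ?thesis
      by (intro antisym SUP_least SUP_upper2[of n]) auto
  next
    case False
    hence "indicator {1 - a n..a n} y = (0 :: ennreal)" for n
      using a[of n] by (auto simp: indicator_def)
    with False show ?thesis by simp
  qed
  \<comment> \<open>If \<open>t\<close> vanishes at an end point, division by zero makes the
    integrand 0 there; two points form a null set in any case.\<close>
  have "len = (\<integral>\<^sup>+y. ?g y * indicator {0<..<1} y \<partial>lborel)"
    unfolding len_def
  proof (rule nn_integral_cong_AE)
    show "AE y in lborel. ?g y * indicator {0..1} y = ?g y * indicator {0<..<1} y"
      using AE_lborel_singleton[of 0] AE_lborel_singleton[of 1]
      by eventually_elim (auto simp: indicator_def)
  qed
  also have "\<dots> = (SUP n. \<integral>\<^sup>+y. ?f n y \<partial>lborel)"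
    using nn_integral_monotone_convergence_SUP[OF inc meas] by (simp add: sup)
  also have "\<dots> = (SUP n. ennreal (2 * S (a n)))"
    using nn_integral_middle[OF a] by simp
  also have "\<dots> \<le> ennreal B"
    using B a by (intro SUP_least ennreal_leI) auto
  finally show ?thesis .
qed

lemma len_sq_le:
  assumes B: "\<And>x. 1/2 \<le> x \<Longrightarrow> x < 1 \<Longrightarrow> (S x)\<^sup>2 \<le> B"
  obtains l where "len = ennreal l" "0 < l" "l\<^sup>2 \<le> 4 * B"
proof -
  have B0: "0 \<le> B"
    using B[of "1/2"] S_mid by simp
  have le: "len \<le> ennreal (2 * sqrt B)"
    using B S_nonneg by (intro len_le) (auto intro!: real_le_rsqrt)
  then obtain l where l: "len = ennreal l" "0 \<le> l"
    by (metis ennreal_cases ennreal_less_top infinity_ennreal_def leD)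
  have "2 * S (3/4) \<le> l"
    using S_le_len[of "3/4"] l by (simp add: ennreal_le_iff)
  moreover have "l \<le> 2 * sqrt B"
    using le l B0 by (simp add: ennreal_le_iff)
  hence "l\<^sup>2 \<le> (2 * sqrt B)\<^sup>2"
    using l by (intro power_mono)
  ultimately show thesis
    using that[of l] l S_pos B0 by (simp add: power_mult_distrib)
qed

lemma S_le_len_real:
  assumes "len = ennreal l" "0 \<le> l" "1/2 \<le> x" "x < 1"
  shows "2 * S x \<le> l"
  using S_le_len[OF assms(3,4)] assms(1,2) by (simp add: ennreal_le_iff)

text \<open>Beyond \<open>x\<close> the function \<open>e - K * S^2 / 2\<close> is at least its
  value at \<open>x\<close>, while \<open>e\<close> is at most \<open>e 1\<close>. This bounds
  \<open>S^2\<close>, hence the length. The choice \<open>x = 1/2\<close> gives the curvature bound;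
  general \<open>x\<close> gives rigidity in the equality case.\<close>

lemma len_sq_le_gap:
  assumes K: "0 < K" "\<And>x. x \<in> {0<..<1} \<Longrightarrow> K \<le> \<kappa> x" and x: "1/2 \<le> x" "x < 1"
  obtains l where "len = ennreal l" "0 < l" "K * l\<^sup>2 / 8 \<le> e 1 - (e x - K * (S x)\<^sup>2 / 2)"
proof -
  define G where "G = e 1 - (e x - K * (S x)\<^sup>2 / 2)"
  let ?B = "2 * G / K"
  have "(S y)\<^sup>2 \<le> ?B" if y: "1/2 \<le> y" "y < 1" for y
  proof -
    \<comment> \<open>The comparison starts at \<open>x\<close>, so a point to its left is first
      moved to \<open>x\<close>.\<close>
    let ?z = "max x y"
    have "(S y)\<^sup>2 \<le> (S ?z)\<^sup>2"
      using x y S_mono[of y ?z] S_nonneg[of y] by (intro power_mono) auto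
    moreover have "e x - K * (S x)\<^sup>2 / 2 \<le> e ?z - K * (S ?z)\<^sup>2 / 2"
      using x y by (intro e_minus_quadratic_mono K) auto
    moreover have "e ?z \<le> e 1"
      using x y by (intro e_le_end) auto
    ultimately have "K * (S ?z)\<^sup>2 \<le> 2 * G" "(S y)\<^sup>2 \<le> (S ?z)\<^sup>2"
      by (auto simp: G_def)
    hence "(S ?z)\<^sup>2 \<le> ?B"
      using K(1) by (simp add: pos_le_divide_eq mult.commute)
    thus ?thesis
      using \<open>(S y)\<^sup>2 \<le> (S ?z)\<^sup>2\<close> by linarith
  qed
  from len_sq_le[OF this] obtain l where "len = ennreal l" "0 < l" "l\<^sup>2 \<le> 4 * ?B" .
  moreover from this have "K * l\<^sup>2 / 8 \<le> G"
    using K(1) by (simp add: pos_le_divide_eq mult.commute)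
  ultimately show thesis
    using that[of l] by (simp add: G_def)
qed

section \<open>The upper bound for the infimum of the curvature\<close>

definition \<kappa>_min :: ereal where
  "\<kappa>_min = (INF x\<in>{0<..<1}. ereal (\<kappa> x))"

definition bound :: ereal where
  "bound = 8 * (ereal (e 1 - e (1/2)) / (enn2ereal len)\<^sup>2)"

lemma bound_infinite: "len = \<infinity> \<Longrightarrow> bound = 0"
  by (simp add: bound_def)

lemma bound_finite: "len = ennreal l \<Longrightarrow> 0 < l \<Longrightarrow> bound = ereal (8 * (e 1 - e (1/2)) / l\<^sup>2)"
  by (simp add: bound_def enn2ereal_ennreal)

lemma len_cases:
  obtains "len = \<infinity>" | l where "len = ennreal l" "0 < l"
proof (cases len rule: ennreal_cases)
  case (real l)
  thus ?thesis
    using that(2)[of l] S_le_len_real[of l "3/4"] S_pos by simp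
qed (use that in simp)

lemma \<kappa>_min_le: "x \<in> {0<..<1} \<Longrightarrow> \<kappa>_min \<le> ereal (\<kappa> x)"
  unfolding \<kappa>_min_def by (rule INF_lower)

lemma bound_nonneg: "0 \<le> bound"
  by (rule len_cases) (use e_ge_mid[of 1] in \<open>auto simp: bound_infinite bound_finite\<close>)

text \<open>A nonpositive infimum lies below the nonnegative bound. A positive one is finite and, by
  \<open>len_sq_le_gap\<close> at the midpoint, forces finite length and the estimate.\<close>

theorem \<kappa>_min_le_bound: "\<kappa>_min \<le> bound"
proof (cases "\<kappa>_min \<le> 0")
  case True
  thus ?thesis
    using bound_nonneg by (rule order_trans)
next
  case False
  moreover have "\<kappa>_min \<noteq> \<infinity>"
    using \<kappa>_min_le[of "1/2"] by auto
  ultimately obtain K where K: "\<kappa>_min = ereal K" "0 < K"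
    by (cases \<kappa>_min) auto
  have "K \<le> \<kappa> x" if "x \<in> {0<..<1}" for x
    using \<kappa>_min_le[OF that] K(1) by simp
  from len_sq_le_gap[OF K(2) this, of "1/2"] obtain l where
    "len = ennreal l" "0 < l" "K * l\<^sup>2 / 8 \<le> e 1 - e (1/2)"
    by (auto simp: S_mid)
  thus ?thesis
    unfolding K(1) by (simp add: bound_finite field_simps)
qed

section \<open>Equality implies the relation between weight and energy\<close>

text \<open>Squeeze: \<open>e - K * S^2 / 2\<close> starts at \<open>e (1/2)\<close> and does not
  decrease, while \<open>len_sq_le_gap\<close> with the extremal \<open>K\<close> caps it at
  \<open>e (1/2)\<close>. Differentiating the constant gives \<open>v = K * S\<close>.\<close>

lemma v_eq_linear_if_finite:
  assumes K: "\<And>x. x \<in> {0<..<1} \<Longrightarrow> K \<le> \<kappa> x"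
    and l: "len = ennreal l" "0 < l" "K = 8 * (e 1 - e (1/2)) / l\<^sup>2"
    and x: "1/2 < x" "x < 1"
  shows "e x - K * (S x)\<^sup>2 / 2 = e (1/2)" "v x = K * S x"
proof -
  have K0: "0 \<le> K"
    using l e_ge_mid[of 1] by simp
  have gap: "e y - K * (S y)\<^sup>2 / 2 = e (1/2)" if y: "1/2 \<le> y" "y < 1" for y
  proof (rule antisym)
    show "e (1/2) \<le> e y - K * (S y)\<^sup>2 / 2"
      using e_minus_quadratic_mono[of K "1/2" y, OF K] y by (simp add: S_mid)
    show "e y - K * (S y)\<^sup>2 / 2 \<le> e (1/2)"
    \<comment> \<open>For \<open>K = 0\<close> the value of \<open>K\<close> says
      \<open>e 1 = e (1/2)\<close>, and \<open>e\<close> is largest at the end.\<close>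
    proof (cases "K = 0")
      case True
      thus ?thesis
        using l e_le_end[of y] y by simp
    next
      case False
      with K0 have "0 < K" by simp
      from len_sq_le_gap[OF this K y] obtain l' where
        l': "len = ennreal l'" "0 < l'" "K * l'\<^sup>2 / 8 \<le> e 1 - (e y - K * (S y)\<^sup>2 / 2)" .
      moreover have "l' = l"
        using l' l by simp
      moreover have "K * l\<^sup>2 / 8 = e 1 - e (1/2)"
        using l by simp
      ultimately show ?thesis by simp
    qed
  qed
  show "e x - K * (S x)\<^sup>2 / 2 = e (1/2)"
    using gap x by simp
  have x01: "x \<in> {0<..<1}"
    using x by auto
  have "((\<lambda>x. e x - K * (S x)\<^sup>2 / 2) has_real_derivative 0) (at x)"
    by (rule has_field_derivative_transform_within_open[of "\<lambda>_. e (1/2)" _ _ "{1/2<..<1}"])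
       (use x gap in auto)
  from DERIV_unique[OF this e_minus_quadratic_deriv[OF x01]] show "v x = K * S x"
    using t_pos[OF x01] by simp
qed

text \<open>If \<open>v x > 0\<close>, then from \<open>x\<close> on the energy grows at rate at
  least \<open>v x\<close> per unit of arc length. As \<open>e\<close> is at most
  \<open>e 1\<close>, the length would be finite.\<close>

lemma v_eq_0_if_infinite:
  assumes \<kappa>: "\<And>x. x \<in> {0<..<1} \<Longrightarrow> 0 \<le> \<kappa> x" and "len = \<infinity>" and x: "1/2 < x" "x < 1"
  shows "v x = 0"
proof (rule ccontr)
  assume "v x \<noteq> 0"
  moreover have "0 \<le> v x"
    using v_minus_linear_mono[of 0 "1/2" x, OF \<kappa>] x by (simp add: v_mid)
  ultimately have vx: "0 < v x" by simp
  have "S y \<le> S x + (e 1 - e x) / v x" if y: "1/2 \<le> y" "y < 1" for y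
  proof (cases "x \<le> y")
    case True
    have "e x - v x * S x \<le> e y - v x * S y"
    proof (rule DERIV_nonneg_imp_nondecreasing[OF True])
      fix z assume z: "x \<le> z" "z \<le> y"
      hence z01: "z \<in> {0<..<1}"
        using x y by auto
      have "((\<lambda>z. e z - v x * S z) has_real_derivative d z - v x * (1 / sqrt (t z))) (at z)"
        using z01 by (auto intro!: derivative_eq_intros e_deriv S_deriv)
      moreover have "v x \<le> v z"
        using v_minus_linear_mono[of 0 x z, OF \<kappa>] x y z by simp
      hence "0 \<le> d z - v x * (1 / sqrt (t z))"
        using t_pos[OF z01] d_eq[OF z01] by (simp add: divide_right_mono)
      ultimately show "\<exists>D. ((\<lambda>z. e z - v x * S z) has_real_derivative D) (at z) \<and> 0 \<le> D"
        by blast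
    qed
    moreover have "e y \<le> e 1"
      using y by (intro e_le_end) auto
    ultimately have "v x * S y \<le> v x * S x + (e 1 - e x)"
      by simp
    thus ?thesis
      using vx by (simp add: field_simps)
  next
    case False
    hence "S y \<le> S x"
      using x y by (intro S_mono) auto
    moreover have "0 \<le> (e 1 - e x) / v x"
      using vx e_le_end[of x] x by simp
    ultimately show ?thesis by simp
  qed
  hence "len \<le> ennreal (2 * (S x + (e 1 - e x) / v x))"
    by (intro len_le mult_left_mono) auto
  thus False
    using \<open>len = \<infinity>\<close> by (simp add: top_unique)
qed

theorem equality_imp_relation:
  assumes "\<kappa>_min = bound"
  obtains C where "\<And>x. x \<in> {0..1} \<Longrightarrow> t x * (d x)\<^sup>2 = 2 * C * (e x - e (1/2))"
proof -
  obtain C where right: "\<And>x. 1/2 < x \<Longrightarrow> x < 1 \<Longrightarrow> (v x)\<^sup>2 = 2 * C * (e x - e (1/2))"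
  proof (cases rule: len_cases)
    \<comment> \<open>Infinite length makes the bound 0, so \<open>\<kappa>\<close> is nonnegative,
      \<open>v\<close> vanishes and the constant 0 works.\<close>
    case 1
    hence "0 \<le> \<kappa> x" if "x \<in> {0<..<1}" for x
      using \<kappa>_min_le[OF that] assms bound_infinite by (simp flip: zero_ereal_def)
    thus ?thesis
      using that[of 0] v_eq_0_if_infinite[OF _ 1] by simp
  next
    case (2 l)
    define K where "K = 8 * (e 1 - e (1/2)) / l\<^sup>2"
    have "\<kappa>_min = ereal K"
      using assms bound_finite[OF 2] by (simp add: K_def)
    hence K: "K \<le> \<kappa> x" if "x \<in> {0<..<1}" for x
      using \<kappa>_min_le[OF that] by simp
    show ?thesis
    proof (rule that[of K])
      fix x :: real assume x: "1/2 < x" "x < 1"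
      have "v x = K * S x" "2 * (e x - e (1/2)) = K * (S x)\<^sup>2"
        using v_eq_linear_if_finite[OF K 2 K_def x] by auto
      thus "(v x)\<^sup>2 = 2 * K * (e x - e (1/2))"
        by (simp add: power2_eq_square)
    qed
  qed
  \<comment> \<open>Reflection carries the relation to the left half: \<open>v\<close> is odd and
    \<open>e\<close> is even.\<close>
  have "(v x)\<^sup>2 = 2 * C * (e x - e (1/2))" if x: "x \<in> {0<..<1}" for x
  proof (cases x "1/2 :: real" rule: linorder_cases)
    case less
    thus ?thesis
      using right[of "1 - x"] x v_odd[OF x] e_sym[of x] by simp
  next
    case equal
    thus ?thesis by (simp only: v_mid) simp
  next
    case greater
    thus ?thesis using right x by simp
  qed
  hence inner: "t x * (d x)\<^sup>2 - 2 * C * (e x - e (1/2)) = 0" if "x \<in> {0<..<1}" for x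
    using that v_sq by simp
  have "continuous_on {0..1} e"
    by (meson DERIV_isCont continuous_at_imp_continuous_on e_deriv)
  \<comment> \<open>The end points are reached by continuity on the closed interval.\<close>
  hence cont: "continuous_on (closure {0<..<1}) (\<lambda>x. t x * (d x)\<^sup>2 - 2 * C * (e x - e (1/2)))"
    by (auto intro!: continuous_intros t_cont d_cont)
  show thesis
  proof (rule that[of C])
    fix x :: real assume "x \<in> {0..1}"
    hence "x \<in> closure {0<..<1}" by simp
    from continuous_constant_on_closure[OF cont inner this]
    show "t x * (d x)\<^sup>2 = 2 * C * (e x - e (1/2))" by simp
  qed
qed

section \<open>The relation implies equality\<close>

text \<open>Differentiate both sides of the relation, write \<open>d\<close> as
  \<open>v / sqrt t\<close>, and cancel \<open>v\<close>.\<close>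

lemma \<kappa>_eq_if_relation:
  assumes rel: "\<And>x. x \<in> {0<..<1} \<Longrightarrow> (v x)\<^sup>2 = 2 * C * (e x - e (1/2))"
    and x: "x \<in> {0<..<1}" "v x \<noteq> 0"
  shows "\<kappa> x = C"
proof -
  have "((\<lambda>x. (v x)\<^sup>2) has_real_derivative 2 * v x * (\<kappa> x * (1 / sqrt (t x)))) (at x)"
    using x by (auto intro!: derivative_eq_intros v_deriv)
  moreover have "((\<lambda>x. (v x)\<^sup>2) has_real_derivative 2 * C * d x) (at x)"
  proof (rule has_field_derivative_transform_within_open[of "\<lambda>x. 2 * C * (e x - e (1/2))" _ _ "{0<..<1}"])
    show "((\<lambda>x. 2 * C * (e x - e (1/2))) has_real_derivative 2 * C * d x) (at x)"
      using x by (auto intro!: derivative_eq_intros e_deriv)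
  qed (use x rel in auto)
  ultimately have "2 * v x * (\<kappa> x * (1 / sqrt (t x))) = 2 * C * d x"
    by (rule DERIV_unique)
  thus ?thesis
    using x t_pos[OF x(1)] d_eq[OF x(1)] by simp
qed

lemma \<kappa>_constant_if_relation:
  assumes rel: "\<And>x. x \<in> {0<..<1} \<Longrightarrow> (v x)\<^sup>2 = 2 * C * (e x - e (1/2))"
    and x0: "x0 \<in> {0<..<1}" "v x0 \<noteq> 0"
    and x: "x \<in> {0<..<1}"
  shows "\<kappa> x = C"
proof -
  \<comment> \<open>Either \<open>y\<close> is a limit of points with \<open>v \<noteq> 0\<close>,
    and continuity gives \<open>C\<close>, or \<open>v\<close> vanishes near \<open>y\<close>, and
    its derivative gives 0.\<close>
  have two: "\<kappa> y \<in> {0, C}" if y: "y \<in> {0<..<1}" for y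
  proof (cases "\<exists>\<^sub>F z in at y. v z \<noteq> 0")
    case True
    have "isCont \<kappa> y"
      using \<kappa>_cont y continuous_on_eq_continuous_at open_greaterThanLessThan by blast
    hence lim: "(\<kappa> \<longlongrightarrow> \<kappa> y) (at y)"
      by (simp add: isCont_def)
    have "\<forall>\<^sub>F z in at y. z \<in> {0<..<1}"
      using y by (intro eventually_at_in_open') auto
    hence "\<forall>\<^sub>F z in at y. v z \<noteq> 0 \<longrightarrow> \<kappa> z = C"
      by eventually_elim (use \<kappa>_eq_if_relation[OF rel] in blast)
    hence freq: "\<exists>\<^sub>F z in at y. \<kappa> z = C"
      using True by (rule frequently_rev_mp[rotated])
    show ?thesis
    proof (rule ccontr)
      assume "\<kappa> y \<notin> {0, C}"
      hence "\<forall>\<^sub>F z in at y. \<kappa> z \<noteq> C"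
        using tendsto_imp_eventually_ne[OF lim] by blast
      thus False
        using freq by (simp add: frequently_def)
    qed
  next
    case False
    hence "\<forall>\<^sub>F z in at y. v z = 0"
      by (simp add: frequently_def)
    moreover have "v y = 0"
    proof (rule tendsto_unique)
      show "(v \<longlongrightarrow> v y) (at y)"
        using DERIV_isCont[OF v_deriv[OF y]] by (simp add: isCont_def)
      show "(v \<longlongrightarrow> 0) (at y)"
        using calculation by (rule tendsto_eventually)
    qed simp
    ultimately have "\<forall>\<^sub>F z in nhds y. v z = 0"
      by (simp add: eventually_nhds_conv_at)
    from DERIV_cong_ev[OF refl this refl] have "(v has_real_derivative 0) (at y)"
      by simp
    from DERIV_unique[OF this v_deriv[OF y]] show ?thesis
      using t_pos[OF y] by simp
  qed
  \<comment> \<open>A continuous function with finite range on an interval is constant; the point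
    \<open>x0\<close> fixes the value.\<close>
  have "finite (\<kappa> ` {0<..<1})"
    by (rule finite_subset[of _ "{0, C}"]) (use two in blast, simp)
  hence "\<kappa> constant_on {0<..<1}"
    by (intro continuous_finite_range_constant \<kappa>_cont) simp
  hence "\<kappa> x = \<kappa> x0"
    using x x0 unfolding constant_on_def by metis
  thus ?thesis
    using \<kappa>_eq_if_relation[OF rel x0] by simp
qed

theorem relation_imp_equality:
  assumes rel: "\<And>x. x \<in> {0<..<1} \<Longrightarrow> d x \<noteq> 0 \<Longrightarrow> t x * (d x)\<^sup>2 = 2 * C * (e x - e (1/2))"
  shows "\<kappa>_min = bound"
proof -
  \<comment> \<open>Where \<open>d\<close> vanishes, both sides are 0 by
    \<open>critical_imp_min\<close>.\<close>
  have vrel: "(v x)\<^sup>2 = 2 * C * (e x - e (1/2))" if x: "x \<in> {0<..<1}" for x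
    using rel[OF x] critical_imp_min[OF x] v_sq[OF x] by (cases "d x = 0") auto
  have cont_e: "isCont e 1"
    using e_deriv[of 1] DERIV_isCont by simp
  have end_le: "e 1 \<le> B" if B: "\<And>x. 1/2 < x \<Longrightarrow> x < 1 \<Longrightarrow> e x \<le> B" for B
  proof (rule tendsto_upperbound)
    show "(e \<longlongrightarrow> e 1) (at_left 1)"
      using cont_e by (simp add: isCont_def filterlim_at_split)
    show "\<forall>\<^sub>F x in at_left 1. e x \<le> B"
      using eventually_at_left_real[of "1/2" 1] by (auto elim!: eventually_mono intro: B)
  qed simp
  show ?thesis
  proof (cases "\<exists>x0\<in>{0<..<1}. v x0 \<noteq> 0")
    \<comment> \<open>Here the energy is constant on the simplex, whatever \<open>C\<close> is, and
      both sides of the equality are 0.\<close>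
    case False
    have "\<kappa> x = 0" if x: "x \<in> {0<..<1}" for x
    proof -
      have "(v has_real_derivative 0) (at x)"
        by (rule has_field_derivative_transform_within_open[of "\<lambda>_. 0" _ _ "{0<..<1}"])
           (use False x in auto)
      from DERIV_unique[OF this v_deriv[OF x]] show ?thesis
        using t_pos[OF x] by simp
    qed
    hence "\<kappa>_min = (INF x\<in>{0<..<1::real}. 0)"
      unfolding \<kappa>_min_def by (intro INF_cong) (auto simp: zero_ereal_def)
    moreover have crit: "e x = e (1/2)" if x: "x \<in> {0<..<1}" for x
    proof (rule critical_imp_min[OF x])
      have "v x = 0"
        using False x by blast
      thus "d x = 0"
        using d_eq[OF x] by simp
    qed
    have "e 1 = e (1/2)"
    proof (rule antisym)
      show "e 1 \<le> e (1/2)"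
      proof (rule end_le)
        show "e x \<le> e (1/2)" if "1/2 < x" "x < 1" for x
          using crit[of x] that by simp
      qed
    qed (simp add: e_ge_mid)
    ultimately show ?thesis
      by (simp add: bound_def zero_ereal_def[symmetric])
  next
    case True
    then obtain x0 where x0: "x0 \<in> {0<..<1}" "v x0 \<noteq> 0" by blast
    have "0 < C * (e x0 - e (1/2))"
      using x0 vrel[OF x0(1)] zero_less_power2[of "v x0"] by simp
    moreover have "0 \<le> e x0 - e (1/2)"
      using e_ge_mid[of x0] x0(1) by simp
    ultimately have C: "0 < C"
      using zero_less_mult_pos2 by (metis less_eq_real_def mult_zero_right less_irrefl)
    have \<kappa>: "\<kappa> x = C" if "x \<in> {0<..<1}" for x
      using \<kappa>_constant_if_relation[OF vrel x0 that] .
    \<comment> \<open>Positive constant curvature forces finite length and gives one of the two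
      inequalities between \<open>C * l^2 / 8\<close> and the energy gap.\<close>
    obtain l where l: "len = ennreal l" "0 < l" "C * l\<^sup>2 / 8 \<le> e 1 - e (1/2)"
      by (rule len_sq_le_gap[OF C, of "1/2"]) (auto simp: S_mid \<kappa>)
    have vC: "v x = C * S x" if x: "x \<in> {0<..<1}" for x
    proof -
      have "v x - C * S x = v (1/2) - C * S (1/2)"
        by (rule DERIV_isconst3[of 0 1]) (use x v_minus_linear_deriv[of _ C] \<kappa> in auto)
      thus ?thesis by (simp add: v_mid S_mid)
    qed
    \<comment> \<open>The opposite inequality: \<open>e - e (1/2) = C * S^2 / 2\<close> and
      \<open>S\<close> is at most half the length; then let \<open>x\<close> tend to 1.\<close>
    have "e x \<le> e (1/2) + C * l\<^sup>2 / 8" if x: "1/2 < x" "x < 1" for x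
    proof -
      have "C * (2 * (e x - e (1/2))) = C * (C * (S x)\<^sup>2)"
        using vrel[of x] vC[of x] x by (simp add: power2_eq_square algebra_simps)
      hence "2 * (e x - e (1/2)) = C * (S x)\<^sup>2"
        using C by simp
      moreover have "S x \<le> l / 2" "0 \<le> S x"
        using S_le_len_real[OF l(1), of x] l(2) S_nonneg[of x] x by simp_all
      hence "(S x)\<^sup>2 \<le> (l / 2)\<^sup>2"
        by (intro power_mono)
      hence "C * (S x)\<^sup>2 \<le> C * (l / 2)\<^sup>2"
        using C by simp
      ultimately show ?thesis
        by (simp add: power_divide)
    qed
    hence "e 1 \<le> e (1/2) + C * l\<^sup>2 / 8"
      by (rule end_le)
    hence "8 * (e 1 - e (1/2)) / l\<^sup>2 = C"
      using l by (simp add: field_simps)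
    moreover have "\<kappa>_min = (INF x\<in>{0<..<1::real}. ereal C)"
      unfolding \<kappa>_min_def using \<kappa> by (intro INF_cong) auto
    ultimately show ?thesis
      using bound_finite[OF l(1,2)] by simp
  qed
qed

end

section \<open>Transfer to the simplex\<close>

text \<open>The antiderivative is taken on the open interval because \<open>1 / sqrt t\<close> may
  be non-integrable at the end points; it is then normalised at the midpoint.\<close>

lemma arc_length_exists:
  fixes t :: "real \<Rightarrow> real"
  assumes "continuous_on {0<..<1} t" "\<And>x. x \<in> {0<..<1} \<Longrightarrow> 0 < t x"
  obtains S where "\<And>x. x \<in> {0<..<1} \<Longrightarrow> (S has_real_derivative 1 / sqrt (t x)) (at x)" "S (1/2) = 0"
proof -
  have "isCont (\<lambda>x. 1 / sqrt (t x)) x" if "x \<in> {0<..<1}" for x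
  proof -
    have "isCont t x"
      using assms(1) that continuous_on_eq_continuous_at open_greaterThanLessThan by blast
    thus ?thesis
      using assms(2)[OF that] by (intro continuous_intros) auto
  qed
  hence "\<exists>F. \<forall>x. ereal 0 < ereal x \<longrightarrow> ereal x < ereal 1 \<longrightarrow> (F has_vector_derivative 1 / sqrt (t x)) (at x)"
    by (intro einterval_antiderivative) auto
  then obtain F where F: "\<And>x. x \<in> {0<..<1} \<Longrightarrow> (F has_real_derivative 1 / sqrt (t x)) (at x)"
    by (auto simp: has_real_derivative_iff_has_vector_derivative)
  show thesis
  proof (rule that[of "\<lambda>x. F x - F (1/2)"])
    fix x :: real assume "x \<in> {0<..<1}"
    from DERIV_diff[OF F[OF this] DERIV_const[of "F (1/2)"]]
    show "((\<lambda>x. F x - F (1/2)) has_real_derivative 1 / sqrt (t x)) (at x)" by simp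
  qed simp
qed

lemma simplex_K2_eq: "simplex_K2 = (\<lambda>x. (x, 1 - x)) ` {0..1}"
  by (auto simp: simplex_K2_def image_iff)

lemma interior_K2_eq: "interior_K2 = (\<lambda>x. (x, 1 - x)) ` {0<..<1}"
  by (auto simp: interior_K2_def image_iff)

text \<open>The relation is required only where its denominator is nonzero: at the midpoint it reads
  0/0. The open set \<open>U\<close> provides two-sided derivatives of \<open>E\<close> at the end
  points of the simplex.\<close>

theorem mainTheorem8:
  fixes E \<theta> :: "real \<times> real \<Rightarrow> real" and U :: "(real \<times> real) set"
  assumes "open U" and "simplex_K2 \<subseteq> U" and "Cinf_on U E"
    and "\<And>p1 p2. (p1, p2) \<in> simplex_K2 \<Longrightarrow> E (p1, p2) = E (p2, p1)"
    and "convex_on simplex_K2 E"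
    and "weight_function \<theta>"
  shows "ricci_min_K2 \<theta> E \<le> 8 * (ereal (E (1, 0) - E (1/2, 1/2)) / (length_K2 \<theta>)\<^sup>2)
    \<and> (ricci_min_K2 \<theta> E = 8 * (ereal (E (1, 0) - E (1/2, 1/2)) / (length_K2 \<theta>)\<^sup>2)
        \<longleftrightarrow> (\<exists>C::real. \<forall>p\<in>simplex_K2. pd1 E p \<noteq> pd2 E p \<longrightarrow>
               \<theta> p = 2 * C * ((E p - E (1/2, 1/2)) / (pd1 E p - pd2 E p)\<^sup>2)))"
proof -
  let ?\<gamma> = "\<lambda>x::real. (x, 1 - x)"
  let ?Q = "{0<..} \<times> {0<..} :: (real \<times> real) set"
  define e where "e x = E (?\<gamma> x)" for x
  define d where "d x = pd1 E (?\<gamma> x) - pd2 E (?\<gamma> x)" for x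
  define c where "c x = pd1 (pd1 E) (?\<gamma> x) - 2 * pd1 (pd2 E) (?\<gamma> x) + pd2 (pd2 E) (?\<gamma> x)" for x
  define t where "t x = \<theta> (?\<gamma> x)" for x
  define t' where "t' x = pd1 \<theta> (?\<gamma> x) - pd2 \<theta> (?\<gamma> x)" for x
  have \<gamma>U: "?\<gamma> x \<in> U" if "x \<in> {0..1}" for x
    using assms(2) that by (auto simp: simplex_K2_eq)
  have \<gamma>Q: "?\<gamma> x \<in> ?Q" if "x \<in> {0<..<1}" for x
    using that by auto
  have \<gamma>_cont: "continuous_on A ?\<gamma>" for A
    by (intro continuous_intros)
  \<comment> \<open>Unfolding \<open>Ck_on 2\<close> yields continuity of the second partials;
    continuity of the first ones is read off \<open>Ck_on 1\<close>.\<close>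
  have E2: "Ck_on 2 U E" and E1: "Ck_on 1 U E"
    using assms(3) by (auto simp: Cinf_on_def)
  have E_diff: "E differentiable (at q)" "pd1 E differentiable (at q)" "pd2 E differentiable (at q)"
    if "q \<in> U" for q
    using E2 that by (auto simp: numeral_2_eq_2)
  have E_cont: "continuous_on U (pd1 E)" "continuous_on U (pd2 E)" "continuous_on U (pd1 (pd1 E))"
    "continuous_on U (pd1 (pd2 E))" "continuous_on U (pd2 (pd2 E))"
    using E2 E1 by (auto simp: numeral_2_eq_2)
  note \<theta> = assms(6)[unfolded weight_function_def]
  have "Ck_on 1 ?Q \<theta>"
    using \<theta> by (auto simp: Cinf_on_def)
  hence \<theta>_diff: "\<And>q. q \<in> ?Q \<Longrightarrow> \<theta> differentiable (at q)"
    and \<theta>_cont: "continuous_on ?Q (pd1 \<theta>)" "continuous_on ?Q (pd2 \<theta>)"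
    by auto
  have U_comp: "continuous_on {0..1} (\<lambda>x. f (?\<gamma> x))" if "continuous_on U f" for f :: "real \<times> real \<Rightarrow> real"
    by (rule continuous_on_compose2[OF that \<gamma>_cont]) (use \<gamma>U in auto)
  have Q_comp: "continuous_on {0<..<1} (\<lambda>x. f (?\<gamma> x))" if "continuous_on ?Q f" for f :: "real \<times> real \<Rightarrow> real"
    by (rule continuous_on_compose2[OF that \<gamma>_cont]) (use \<gamma>Q in auto)
  have t_cont: "continuous_on {0..1} t"
    unfolding t_def[abs_def]
    by (rule continuous_on_compose2[OF _ \<gamma>_cont, of "{0..} \<times> {0..}"]) (use \<theta> in auto)
  have t_pos: "0 < t x" if "x \<in> {0<..<1}" for x
    using that \<theta> by (auto simp: t_def)
  obtain S where S: "\<And>x. x \<in> {0<..<1} \<Longrightarrow> (S has_real_derivative 1 / sqrt (t x)) (at x)" "S (1/2) = 0"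
    by (rule arc_length_exists[of t])
       (use t_pos in \<open>auto intro: continuous_on_subset[OF t_cont]\<close>)
  interpret arc_length_energy e d c t t' S
  proof
    fix x :: real assume x: "x \<in> {0<..<1}"
    hence xU: "?\<gamma> x \<in> U"
      using \<gamma>U by auto
    \<comment> \<open>Both mixed partials appear here and merge into the term
      \<open>2 * pd1 (pd2 E)\<close> of \<open>c\<close>.\<close>
    show "(d has_real_derivative c x) (at x)"
      using DERIV_diff[OF differentiable_imp_antidiagonal_derivative[OF E_diff(2)[OF xU]]
          differentiable_imp_antidiagonal_derivative[OF E_diff(3)[OF xU]]]
        mixed_partials_commute[OF assms(1) xU E2]
      by (simp add: d_def[abs_def] c_def add_diff_eq diff_add_eq)
    show "(t has_real_derivative t' x) (at x)"
      unfolding t_def[abs_def] t'_def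
      by (rule differentiable_imp_antidiagonal_derivative[OF \<theta>_diff[OF \<gamma>Q[OF x]]])
    show "(S has_real_derivative 1 / sqrt (t x)) (at x)" "0 < t x"
      using S x t_pos by auto
    show "t (1 - x) = t x"
      using x \<theta> by (auto simp: t_def)
  next
    fix x :: real assume x: "x \<in> {0..1}"
    show "(e has_real_derivative d x) (at x)"
      unfolding e_def[abs_def] d_def
      by (rule differentiable_imp_antidiagonal_derivative[OF E_diff(1)[OF \<gamma>U[OF x]]])
    show "e (1 - x) = e x"
      using x assms(4)[of x "1 - x"] by (simp add: e_def simplex_K2_def)
  next
    show "continuous_on {0..1} d"
      unfolding d_def[abs_def] by (intro continuous_intros U_comp E_cont)
    show "continuous_on {0<..<1} c"
      unfolding c_def[abs_def]
      by (rule continuous_on_subset[of "{0..1}"]) (intro continuous_intros U_comp E_cont, auto)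
    show "continuous_on {0<..<1} t'"
      unfolding t'_def[abs_def] by (intro continuous_intros Q_comp \<theta>_cont)
    show "convex_on {0..1} e"
    proof (rule convex_onI)
      fix u x y :: real
      assume u: "0 < u" "u < 1" and xy: "x \<in> {0..1}" "y \<in> {0..1}"
      have "?\<gamma> ((1 - u) *\<^sub>R x + u *\<^sub>R y) = (1 - u) *\<^sub>R ?\<gamma> x + u *\<^sub>R ?\<gamma> y"
        by (simp add: algebra_simps)
      thus "e ((1 - u) *\<^sub>R x + u *\<^sub>R y) \<le> (1 - u) * e x + u * e y"
        using convex_onD[OF assms(5), of u "?\<gamma> x" "?\<gamma> y"] u xy by (simp add: e_def simplex_K2_eq)
    qed simp
  qed (use S t_cont in auto)
  have min_eq: "ricci_min_K2 \<theta> E = \<kappa>_min"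
    unfolding ricci_min_K2_def \<kappa>_min_def interior_K2_eq image_image
    by (simp add: ricci_K2_def \<kappa>_def t_def t'_def c_def d_def)
  have bound_eq: "8 * (ereal (E (1, 0) - E (1/2, 1/2)) / (length_K2 \<theta>)\<^sup>2) = bound"
    by (simp add: bound_def length_K2_def len_def e_def t_def)
  have rel_iff: "(\<forall>p\<in>simplex_K2. pd1 E p \<noteq> pd2 E p \<longrightarrow>
               \<theta> p = 2 * C * ((E p - E (1/2, 1/2)) / (pd1 E p - pd2 E p)\<^sup>2))
     \<longleftrightarrow> (\<forall>x\<in>{0..1}. d x \<noteq> 0 \<longrightarrow> t x * (d x)\<^sup>2 = 2 * C * (e x - e (1/2)))" for C
    by (simp add: simplex_K2_eq t_def d_def e_def field_simps)
  show ?thesis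
    unfolding min_eq bound_eq rel_iff
  proof (intro conjI iffI)
    show "\<kappa>_min \<le> bound"
      by (rule \<kappa>_min_le_bound)
    show "\<exists>C. \<forall>x\<in>{0..1}. d x \<noteq> 0 \<longrightarrow> t x * (d x)\<^sup>2 = 2 * C * (e x - e (1/2))" if "\<kappa>_min = bound"
      by (rule equality_imp_relation[OF that]) blast
    show "\<kappa>_min = bound" if "\<exists>C. \<forall>x\<in>{0..1}. d x \<noteq> 0 \<longrightarrow> t x * (d x)\<^sup>2 = 2 * C * (e x - e (1/2))"
    proof -
      from that obtain C where C: "\<forall>x\<in>{0..1}. d x \<noteq> 0 \<longrightarrow> t x * (d x)\<^sup>2 = 2 * C * (e x - e (1/2))" ..
      show ?thesis
      proof (rule relation_imp_equality)
        fix x :: real assume "x \<in> {0<..<1}" and d: "d x \<noteq> 0"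
        hence "x \<in> {0..1}" by simp
        with C d show "t x * (d x)\<^sup>2 = 2 * C * (e x - e (1/2))" by blast
      qed
    qed
  qed
qed

end
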